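(* Let $n\geqslant 3$. The monoids $\mathcal{ODI}_n$, $\mathcal{MDI}_n$ and $\mathcal{OPDI}_n$ are generated (as monoids) by $$\{x,y,e_2,\ldots,e_{n-1},x_1,x_2,\ldots,x_{\lfloor\frac{n-1}{2}\rfloor},y_1,y_2,\ldots,y_{\lfloor\frac{n-1}{2}\rfloor}\},$$ $$\{h,x,e_2,\ldots,e_{\lfloor\frac{n+1}{2}\rfloor},x_1,x_2,\ldots,x_{\lfloor\frac{n-1}{2}\rfloor},y_1,y_2,\ldots,y_{\lfloor\frac{n-1}{2}\rfloor}\}$$ and $$\{g,e_i,x_1,x_2,\ldots,x_{\lfloor\frac{n-1}{2}\rfloor}\},\quad\text{with } 1\leqslant i\leqslant n \text{ (for each such } i),$$ respectively.
   Context: Let $\Omega_n=\{1<2<\cdots<n\}$. A partial transformation of $\Omega_n$ is a map $\alpha$ from a subset $\mathrm{Dom}(\alpha)\subseteq\Omega_n$ (possibly empty) to $\Omega_n$; maps are written on the right and composed left to right: $x(\alpha\beta)=(x\alpha)\beta$ with $\mathrm{Dom}(\alpha\beta)=\{x\in\mathrm{Dom}(\alpha)\mid x\alpha\in\mathrm{Dom}(\beta)\}$. The cycle graph $C_n$ has vertex set $\Omega_n$ and edges $\{i,i+1\}$ ($1\leqslant i\leqslant n-1$) and $\{1,n\}$; its geodesic distance is $\mathrm{d}(x,y)=\min\{|x-y|,n-|x-y|\}$. A partial isometry of $C_n$ is a partial transformation $\alpha$ of $\Omega_n$ with $\mathrm{d}(x\alpha,y\alpha)=\mathrm{d}(x,y)$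 for all $x,y\in\mathrm{Dom}(\alpha)$ (such $\alpha$ is necessarily injective). $\mathcal{DI}_n$ is the monoid of all partial isometries of $C_n$ under composition. A partial transformation $\alpha$ is order-preserving [order-reversing] if $x\leqslant y$ implies $x\alpha\leqslant y\alpha$ [$x\alpha\geqslant y\alpha$] for all $x,y\in\mathrm{Dom}(\alpha)$; it is monotone if it is order-preserving or order-reversing. A sequence $(a_1,\ldots,a_t)$ ($t\geqslant 0$) of elements of $\Omega_n$ is cyclic if there is at most one index $i\in\{1,\ldots,t\}$ with $a_i>a_{i+1}$, where $a_{t+1}=a_1$. A partial transformation $\alpha$ with $\mathrm{Dom}(\alpha)=\{a_1<\cdots<a_t\}$ is orientation-preserving if $(a_1\alpha,\ldots,a_t\alpha)$ is cyclic. $\mathcal{ODI}_n$, $\mathcal{MDI}_n$, $\mathcal{OPDI}_n$ are the submonoids of $\mathcal{DI}_n$ of all order-preserving, monotone, and orientation-preserving elements, respectively. Notation for elements: - $g$ and $h$ are the permutations of $\Omega_n$ with $ig=i+1$ for $1\leqslant i\leqslant n-1$, $ng=1$, and $ih=n-i+1$ for $1\leqslant i\leqslant n$. - For $1\leqslant i\leqslant n$, $e_i$ is the partial identity with domain $\Omega_n\setminus\{i\}$. - $x=\begin{pmatrix}1&2&\cdots&n-1\\2&3&\cdots&n\end{pmatrix}$ (domain $\{1,\ldots,n-1\}$) and $y=x^{-1}=\begin{pmatrix}2&3&\cdots&n\\1&2&\cdots&n-1\end{pmatrix}$. - For $1\leqslant i\leqslant\lfloor\frac{n-1}{2}\rfloor$,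 $x_i=\begin{pmatrix}1&1+i\\1&n-i+1\end{pmatrix}$ (domain $\{1,1+i\}$) and $y_i=x_i^{-1}=\begin{pmatrix}1&n-i+1\\1&1+i\end{pmatrix}$. A subset generates a monoid if every element is a finite product of elements of the subset, the identity being the empty product. *)

theory Defs
  imports "HOL-Algebra.Group"
begin

section \<open>Partial transformations of a finite chain\<close>

text \<open>
  A partial transformation of the chain of the first \<open>n\<close> positive integers is a map of
  type \<open>nat \<rightharpoonup> nat\<close> whose domain and range lie in that chain.
\<close>

abbreviation (input) chain :: "nat \<Rightarrow> nat set" where
  "chain n \<equiv> {1..n}"

definition partial_trans :: "nat \<Rightarrow> (nat \<rightharpoonup> nat) set" where
  "partial_trans n = {\<alpha>. dom \<alpha> \<subseteq> chain n \<and> ran \<alpha> \<subseteq> chain n}"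

definition order_preserving :: "(nat \<rightharpoonup> nat) \<Rightarrow> bool" where
  "order_preserving \<alpha> \<longleftrightarrow>
     (\<forall>x\<in>dom \<alpha>. \<forall>y\<in>dom \<alpha>. x \<le> y \<longrightarrow> the (\<alpha> x) \<le> the (\<alpha> y))"

definition order_reversing :: "(nat \<rightharpoonup> nat) \<Rightarrow> bool" where
  "order_reversing \<alpha> \<longleftrightarrow>
     (\<forall>x\<in>dom \<alpha>. \<forall>y\<in>dom \<alpha>. x \<le> y \<longrightarrow> the (\<alpha> x) \<ge> the (\<alpha> y))"

definition monotone_trans :: "(nat \<rightharpoonup> nat) \<Rightarrow> bool" where
  "monotone_trans \<alpha> \<longleftrightarrow> order_preserving \<alpha> \<or> order_reversing \<alpha>"

text \<open>List positions count from 0; the \<open>mod\<close> makes the last entry precede the first one.\<close>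

definition cyclic_seq :: "nat list \<Rightarrow> bool" where
  "cyclic_seq as \<longleftrightarrow> card {i. i < length as \<and> as ! i > as ! (Suc i mod length as)} \<le> 1"

definition orientation_preserving :: "(nat \<rightharpoonup> nat) \<Rightarrow> bool" where
  "orientation_preserving \<alpha> \<longleftrightarrow>
     cyclic_seq (map (\<lambda>a. the (\<alpha> a)) (sorted_list_of_set (dom \<alpha>)))"


section \<open>The cycle graph and its geodesic distance\<close>

definition cycle_edges :: "nat \<Rightarrow> nat set set" where
  "cycle_edges n = {{i, i + 1} | i. i \<in> {1..n - 1}} \<union> {{1, n}}"

text \<open>
  The closed formula for the geodesic distance of the cycle graph, computed in the integers;
  the theorem \<open>cycle_dist_geodesic\<close> below identifies it with the least length of a walk.
\<close>

definition cycle_dist :: "nat \<Rightarrow> nat \<Rightarrow> nat \<Rightarrow> int" where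
  "cycle_dist n x y = min \<bar>int x - int y\<bar> (int n - \<bar>int x - int y\<bar>)"

definition partial_isometry :: "nat \<Rightarrow> (nat \<rightharpoonup> nat) \<Rightarrow> bool" where
  "partial_isometry n \<alpha> \<longleftrightarrow> \<alpha> \<in> partial_trans n \<and>
     (\<forall>x\<in>dom \<alpha>. \<forall>y\<in>dom \<alpha>. cycle_dist n (the (\<alpha> x)) (the (\<alpha> y)) = cycle_dist n x y)"


section \<open>The monoids\<close>

text \<open>
  Maps are written on the right and composed from left to right, whereas \<open>\<beta> \<circ>\<^sub>m \<alpha>\<close>
  applies \<open>\<alpha>\<close> first; hence the swapped arguments in the multiplication.
\<close>

definition DI :: "nat \<Rightarrow> (nat \<rightharpoonup> nat) monoid" where
  "DI n = \<lparr>carrier = {\<alpha>. partial_isometry n \<alpha>},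
           mult = (\<lambda>\<alpha> \<beta>. \<beta> \<circ>\<^sub>m \<alpha>),
           one = Some |` chain n\<rparr>"

definition ODI :: "nat \<Rightarrow> (nat \<rightharpoonup> nat) monoid" where
  "ODI n = (DI n)\<lparr>carrier := {\<alpha> \<in> carrier (DI n). order_preserving \<alpha>}\<rparr>"

definition MDI :: "nat \<Rightarrow> (nat \<rightharpoonup> nat) monoid" where
  "MDI n = (DI n)\<lparr>carrier := {\<alpha> \<in> carrier (DI n). monotone_trans \<alpha>}\<rparr>"

definition OPDI :: "nat \<Rightarrow> (nat \<rightharpoonup> nat) monoid" where
  "OPDI n = (DI n)\<lparr>carrier := {\<alpha> \<in> carrier (DI n). orientation_preserving \<alpha>}\<rparr>"

definition generates_monoid :: "('a, 'b) monoid_scheme \<Rightarrow> 'a set \<Rightarrow> bool" where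
  "generates_monoid M A \<longleftrightarrow> A \<subseteq> carrier M \<and>
     (\<forall>a\<in>carrier M. \<exists>ws. set ws \<subseteq> A \<and> a = foldr (mult M) ws (one M))"


section \<open>The generators\<close>

definition gen_g :: "nat \<Rightarrow> nat \<rightharpoonup> nat" where
  "gen_g n = (\<lambda>i. if i = n then Some 1 else Some (i + 1)) |` chain n"

definition gen_h :: "nat \<Rightarrow> nat \<rightharpoonup> nat" where
  "gen_h n = (\<lambda>i. Some (n - i + 1)) |` chain n"

definition gen_e :: "nat \<Rightarrow> nat \<Rightarrow> nat \<rightharpoonup> nat" where
  "gen_e n i = Some |` (chain n - {i})"

definition gen_x :: "nat \<Rightarrow> nat \<rightharpoonup> nat" where
  "gen_x n = (\<lambda>i. Some (i + 1)) |` {1..n - 1}"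

definition gen_y :: "nat \<Rightarrow> nat \<rightharpoonup> nat" where
  "gen_y n = (\<lambda>i. Some (i - 1)) |` {2..n}"

definition gen_xi :: "nat \<Rightarrow> nat \<Rightarrow> nat \<rightharpoonup> nat" where
  "gen_xi n i = [1 \<mapsto> 1, 1 + i \<mapsto> n - i + 1]"

definition gen_yi :: "nat \<Rightarrow> nat \<Rightarrow> nat \<rightharpoonup> nat" where
  "gen_yi n i = [1 \<mapsto> 1, n - i + 1 \<mapsto> 1 + i]"


section \<open>The closed formula is the geodesic distance\<close>

definition cycle_adj :: "nat \<Rightarrow> (nat \<times> nat) set" where
  "cycle_adj n = {(i, j). {i, j} \<in> cycle_edges n}"

lemma cycle_adj_iff:
  "(i, j) \<in> cycle_adj n \<longleftrightarrow>
     (i \<in> {1..n - 1} \<and> j = i + 1) \<or> (j \<in> {1..n - 1} \<and> i = j + 1) \<or> (i = 1 \<and> j = n) \<or> (i = n \<and> j = 1)"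
  unfolding cycle_adj_def cycle_edges_def by (auto simp: doubleton_eq_iff)

lemma cycle_adj_sym: "sym (cycle_adj n)"
  by (auto simp: sym_def cycle_adj_def insert_commute)

lemma relpow_sym: "sym R \<Longrightarrow> (x, y) \<in> R ^^ k \<Longrightarrow> (y, x) \<in> R ^^ k"
proof (induction k arbitrary: y)
  case (Suc k)
  then obtain z where z: "(x, z) \<in> R ^^ k" "(z, y) \<in> R" by auto
  have "(z, x) \<in> R ^^ k" by (rule Suc.IH[OF Suc.prems(1) z(1)])
  moreover have "(y, z) \<in> R" using Suc.prems(1) z(2) by (rule symD)
  ultimately show ?case by (blast intro: relpow_Suc_I2)
qed auto

lemma cycle_walk_up:
  "1 \<le> x \<Longrightarrow> x + k \<le> n \<Longrightarrow> (x, x + k) \<in> cycle_adj n ^^ k"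
proof (induction k)
  case (Suc k)
  then have "(x + k, x + Suc k) \<in> cycle_adj n" by (auto simp: cycle_adj_iff)
  with Suc show ?case by (auto intro: relpow_Suc_I)
qed auto

lemma cycle_walk_dist:
  assumes "3 \<le> n" "x \<in> chain n" "(x, y) \<in> cycle_adj n ^^ k"
  shows "y \<in> chain n \<and> cycle_dist n x y \<le> int k"
  using assms(3)
proof (induction k arbitrary: y)
  case 0
  then show ?case using assms by (auto simp: cycle_dist_def)
next
  case (Suc k)
  then obtain z where z: "(x, z) \<in> cycle_adj n ^^ k" "(z, y) \<in> cycle_adj n" by auto
  from Suc.IH[OF z(1)] z(2) show ?case
    using assms(1,2) by (auto simp: cycle_dist_def cycle_adj_iff)
qed

lemma cycle_walk_exists:
  assumes "3 \<le> n" "x \<in> chain n" "y \<in> chain n" "x \<le> y"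
  shows "(x, y) \<in> cycle_adj n ^^ nat (cycle_dist n x y)"
proof (cases "int y - int x \<le> int n - (int y - int x)")
  case True
  then have "nat (cycle_dist n x y) = y - x" using assms by (auto simp: cycle_dist_def)
  then show ?thesis using cycle_walk_up[of x "y - x" n] assms by auto
next
  case False
  then have d: "nat (cycle_dist n x y) = (x - 1) + (1 + (n - y))"
    using assms by (auto simp: cycle_dist_def)
  have "(x, 1) \<in> cycle_adj n ^^ (x - 1)"
    using relpow_sym[OF cycle_adj_sym cycle_walk_up[of 1 "x - 1" n]] assms by auto
  moreover have "(1, n) \<in> cycle_adj n ^^ 1" by (auto simp: cycle_adj_iff)
  moreover have "(n, y) \<in> cycle_adj n ^^ (n - y)"
    using relpow_sym[OF cycle_adj_sym cycle_walk_up[of y "n - y" n]] assms by auto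
  ultimately show ?thesis unfolding d relpow_add by blast
qed

theorem cycle_dist_geodesic:
  assumes "3 \<le> n" "x \<in> chain n" "y \<in> chain n"
  shows "cycle_dist n x y = int (LEAST k. (x, y) \<in> cycle_adj n ^^ k)"
proof -
  have w: "(x, y) \<in> cycle_adj n ^^ nat (cycle_dist n x y)"
  proof (cases "x \<le> y")
    case False
    then have "(y, x) \<in> cycle_adj n ^^ nat (cycle_dist n y x)"
      using cycle_walk_exists assms by auto
    moreover have "cycle_dist n y x = cycle_dist n x y"
      by (auto simp: cycle_dist_def)
    ultimately show ?thesis using relpow_sym[OF cycle_adj_sym] by simp
  qed (use cycle_walk_exists assms in auto)
  have "0 \<le> cycle_dist n x y" using assms by (auto simp: cycle_dist_def)
  moreover have "(LEAST k. (x, y) \<in> cycle_adj n ^^ k) = nat (cycle_dist n x y)"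
  proof (rule Least_equality, rule w)
    fix k assume "(x, y) \<in> cycle_adj n ^^ k"
    then show "nat (cycle_dist n x y) \<le> k"
      using cycle_walk_dist[OF assms(1,2), of y k] by linarith
  qed
  ultimately show ?thesis by simp
qed


section \<open>The monoids are well defined\<close>

lemma DI_simps:
  "\<alpha> \<in> carrier (DI n) \<longleftrightarrow> partial_isometry n \<alpha>"
  "mult (DI n) \<alpha> \<beta> = \<beta> \<circ>\<^sub>m \<alpha>"
  "one (DI n) = Some |` chain n"
  by (auto simp: DI_def)

lemma dom_comp: "x \<in> dom (\<beta> \<circ>\<^sub>m \<alpha>) \<longleftrightarrow> x \<in> dom \<alpha> \<and> the (\<alpha> x) \<in> dom \<beta>"
  by (auto simp: map_comp_def split: option.splits)

lemma the_comp: "x \<in> dom (\<beta> \<circ>\<^sub>m \<alpha>) \<Longrightarrow> the ((\<beta> \<circ>\<^sub>m \<alpha>) x) = the (\<beta> (the (\<alpha> x)))"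
  by (auto simp: map_comp_def split: option.splits)

lemma dom_one [simp]: "dom (Some |` A) = A"
  by (auto simp: restrict_map_def split: if_splits)

lemma the_one: "x \<in> A \<Longrightarrow> the ((Some |` A) x) = x"
  by auto

lemma ran_one [simp]: "ran (Some |` A) = A"
  by (auto simp: ran_def restrict_map_def)

lemma partial_isometry_comp:
  assumes "partial_isometry n \<alpha>" "partial_isometry n \<beta>"
  shows "partial_isometry n (\<beta> \<circ>\<^sub>m \<alpha>)"
proof -
  have "ran (\<beta> \<circ>\<^sub>m \<alpha>) \<subseteq> ran \<beta>"
    by (auto simp: ran_def map_comp_def split: option.splits)
  moreover have "dom (\<beta> \<circ>\<^sub>m \<alpha>) \<subseteq> dom \<alpha>" by (rule subsetI) (simp add: dom_comp del: domIff)
  ultimately have "\<beta> \<circ>\<^sub>m \<alpha> \<in> partial_trans n"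
    using assms unfolding partial_isometry_def partial_trans_def mem_Collect_eq
    by (meson subset_trans)
  moreover have "cycle_dist n (the ((\<beta> \<circ>\<^sub>m \<alpha>) x)) (the ((\<beta> \<circ>\<^sub>m \<alpha>) y)) = cycle_dist n x y"
    if "x \<in> dom (\<beta> \<circ>\<^sub>m \<alpha>)" "y \<in> dom (\<beta> \<circ>\<^sub>m \<alpha>)" for x y
    using that assms by (simp add: the_comp dom_comp partial_isometry_def del: domIff)
  ultimately show ?thesis unfolding partial_isometry_def by blast
qed

lemma monoid_DI: "monoid (DI n)"
proof (rule monoidI, goal_cases)
  case (1 \<alpha> \<beta>)
  then show ?case by (simp add: DI_simps partial_isometry_comp)
next
  case 2
  then show ?case
    by (auto simp: DI_simps partial_isometry_def partial_trans_def simp del: domIff)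
next
  case (3 \<alpha> \<beta> \<gamma>)
  then show ?case by (auto simp: DI_simps map_comp_def fun_eq_iff split: option.splits)
next
  case (4 \<alpha>)
  then have "\<alpha> x = None" if "x \<notin> chain n" for x
    using that by (auto simp: DI_simps partial_isometry_def partial_trans_def)
  then show ?case by (auto simp: DI_simps map_comp_def fun_eq_iff restrict_map_def)
next
  case (5 \<alpha>)
  then have "z \<in> chain n" if "\<alpha> x = Some z" for x z
    using that by (auto simp: DI_simps partial_isometry_def partial_trans_def ran_def)
  then show ?case
    by (fastforce simp: DI_simps map_comp_def fun_eq_iff restrict_map_def split: option.splits)
qed

lemma partial_isometry_inj:
  assumes "partial_isometry n \<alpha>"
  shows "inj_on (\<lambda>a. the (\<alpha> a)) (dom \<alpha>)"
proof (rule inj_onI)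
  fix x y assume xy: "x \<in> dom \<alpha>" "y \<in> dom \<alpha>" "the (\<alpha> x) = the (\<alpha> y)"
  then have "x \<in> chain n" "y \<in> chain n"
    using assms unfolding partial_isometry_def partial_trans_def by blast+
  moreover have "cycle_dist n x y = cycle_dist n (the (\<alpha> x)) (the (\<alpha> y))"
    using assms xy(1,2) unfolding partial_isometry_def by metis
  ultimately show "x = y" using xy(3) by (auto simp: cycle_dist_def min_def split: if_splits)
qed

lemma cyclic_seq_iff_rotation:
  "cyclic_seq xs \<longleftrightarrow> (\<exists>us vs. xs = us @ vs \<and> sorted (vs @ us))"
proof
  let ?D = "{i. i < length xs \<and> xs ! i > xs ! (Suc i mod length xs)}"
  assume c: "cyclic_seq xs"
  have fin: "finite ?D" by auto
  have uniq: "i = j" if "i \<in> ?D" "j \<in> ?D" for i j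
    using c that card_le_Suc0_iff_eq[OF fin] unfolding cyclic_seq_def by auto
  show "\<exists>us vs. xs = us @ vs \<and> sorted (vs @ us)"
  proof (cases "\<exists>k. Suc k < length xs \<and> k \<in> ?D")
    case False
    have "xs ! k \<le> xs ! Suc k" if "Suc k < length xs" for k
    proof -
      have "k \<notin> ?D" using False that by blast
      then show ?thesis using that by simp
    qed
    then have "sorted xs" by (simp add: sorted_iff_nth_Suc)
    then show ?thesis by (intro exI[of _ "[]"] exI[of _ xs]) auto
  next
    case True
    then obtain k where k: "Suc k < length xs" "k \<in> ?D" by blast
    have le: "xs ! i \<le> xs ! (Suc i mod length xs)" if "i < length xs" "i \<noteq> k" for i
      using uniq[OF _ k(2), of i] that by fastforce
    have wrap: "xs ! (length xs - 1) \<le> xs ! 0"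
    proof -
      have "Suc (length xs - 1) = length xs" using k by linarith
      then show ?thesis using le[of "length xs - 1"] k by (simp del: One_nat_def)
    qed
    let ?u = "take (Suc k) xs" and ?v = "drop (Suc k) xs"
    have step: "xs ! i \<le> xs ! Suc i" if "Suc i < length xs" "i \<noteq> k" for i
      using le[of i] that by auto
    have su: "sorted ?u" using step k by (auto simp: sorted_iff_nth_Suc)
    have sv: "sorted ?v" using step k by (auto simp: sorted_iff_nth_Suc)
    have "a \<le> b" if a: "a \<in> set ?v" and b: "b \<in> set ?u" for a b
    proof -
      obtain i where i: "i < length ?v" "a = ?v ! i" using a by (metis in_set_conv_nth)
      obtain j where j: "j < length ?u" "b = ?u ! j" using b by (metis in_set_conv_nth)
      have "i \<le> length ?v - 1" "length ?v - 1 < length ?v" using i(1) by linarith+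
      then have "a \<le> ?v ! (length ?v - 1)" unfolding i(2) by (rule sorted_nth_mono[OF sv])
      also have "\<dots> = xs ! (length xs - 1)"
      proof -
        have "Suc k + (length ?v - 1) = length xs - 1" using k(1) by simp
        then show ?thesis using k(1) by (metis nth_drop less_imp_le)
      qed
      also have "\<dots> \<le> ?u ! 0" using wrap by simp
      also have "\<dots> \<le> b" using su j by (metis le0 sorted_nth_mono)
      finally show ?thesis .
    qed
    then have "sorted (?v @ ?u)" using su sv by (auto simp: sorted_append)
    then show ?thesis by (intro exI[of _ ?u] exI[of _ ?v]) auto
  qed
next
  assume "\<exists>us vs. xs = us @ vs \<and> sorted (vs @ us)"
  then obtain us vs where xs: "xs = us @ vs" and s: "sorted (vs @ us)" by blast
  let ?k = "if us = [] then length xs - 1 else length us - 1"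
  have "i = ?k" if i: "i < length xs" "xs ! i > xs ! (Suc i mod length xs)" for i
  proof (rule ccontr)
    assume ne: "i \<noteq> ?k"
    consider "Suc i < length us" | "length us \<le> i" "Suc i < length xs"
      | "us \<noteq> []" "vs \<noteq> []" "Suc i = length xs"
      using i ne xs by (cases "us = []"; cases "vs = []"; fastforce)
    then show False
    proof cases
      case 1
      then have "us ! i \<le> us ! Suc i"
        using s sorted_append sorted_iff_nth_Suc by blast
      then show False using 1 i xs by (auto simp: nth_append)
    next
      case 2
      then have "Suc (i - length us) < length vs" "Suc i - length us = Suc (i - length us)"
        using xs by auto
      then have "vs ! (i - length us) \<le> vs ! (Suc i - length us)"
        using s by (metis sorted_append sorted_iff_nth_Suc)
      then show False using 2 i xs by (auto simp: nth_append)
    next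
      case 3
      then have "i = length xs - 1" by simp
      then have "xs ! i = last xs" "xs ! 0 = hd xs"
        using 3 xs last_conv_nth[of xs] hd_conv_nth[of xs] by auto
      then have "xs ! i = last vs" "xs ! 0 = hd us" using 3 xs by simp_all
      moreover have "last vs \<le> hd us" using s 3 by (auto simp: sorted_append)
      ultimately show False using i 3 by simp
    qed
  qed
  then have "{i. i < length xs \<and> xs ! i > xs ! (Suc i mod length xs)} \<subseteq> {?k}" by blast
  then show "cyclic_seq xs"
    unfolding cyclic_seq_def by (metis (lifting) card.empty card_mono card_insert_disjoint
        empty_iff finite.emptyI finite_insert One_nat_def)
qed

lemma cyclic_seq_rotate:
  assumes "cyclic_seq (a @ b)"
  shows "cyclic_seq (b @ a)"
proof -
  obtain us vs where uv: "a @ b = us @ vs" "sorted (vs @ us)"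
    using assms by (auto simp: cyclic_seq_iff_rotation)
  then consider c where "a = us @ c" "vs = c @ b" | c where "us = a @ c" "b = c @ vs"
    by (auto simp: append_eq_append_conv2)
  then show ?thesis
  proof cases
    case 1
    then show ?thesis unfolding cyclic_seq_iff_rotation using uv(2)
      by (intro exI[of _ "b @ us"] exI[of _ c]) auto
  next
    case 2
    then show ?thesis unfolding cyclic_seq_iff_rotation using uv(2)
      by (intro exI[of _ c] exI[of _ "vs @ a"]) auto
  qed
qed

lemma cyclic_seq_filter:
  assumes "cyclic_seq (map f xs)"
  shows "cyclic_seq (map f (filter P xs))"
proof -
  obtain us vs where uv: "map f xs = us @ vs" "sorted (vs @ us)"
    using assms by (auto simp: cyclic_seq_iff_rotation)
  then obtain as bs where ab: "xs = as @ bs" "us = map f as" "vs = map f bs"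
    by (auto simp: map_eq_append_conv)
  have "sorted (map f (bs @ as))" using uv(2) ab by simp
  then have "sorted (map f (filter P (bs @ as)))" by (rule sorted_filter)
  then show ?thesis unfolding cyclic_seq_iff_rotation ab(1)
    by (intro exI[of _ "map f (filter P as)"] exI[of _ "map f (filter P bs)"]) auto
qed

lemma finite_dom_isometry: "partial_isometry n \<alpha> \<Longrightarrow> finite (dom \<alpha>)"
  unfolding partial_isometry_def partial_trans_def by (auto intro: finite_subset)

lemma orientation_preserving_comp:
  assumes "partial_isometry n \<alpha>" "partial_isometry n \<beta>"
    and "orientation_preserving \<alpha>" "orientation_preserving \<beta>"
  shows "orientation_preserving (\<beta> \<circ>\<^sub>m \<alpha>)"
proof -
  define xs where "xs = sorted_list_of_set (dom \<alpha>)"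
  define zs where "zs = sorted_list_of_set (dom \<beta>)"
  define f where "f = (\<lambda>a. the (\<alpha> a))"
  define k where "k = (\<lambda>a. the (\<beta> a))"
  have xs: "set xs = dom \<alpha>" "distinct xs" "sorted xs"
    using finite_dom_isometry[OF assms(1)] by (auto simp: xs_def)
  have zs: "set zs = dom \<beta>" "distinct zs" "sorted zs"
    using finite_dom_isometry[OF assms(2)] by (auto simp: zs_def)
  have "cyclic_seq (map f xs)" "cyclic_seq (map k zs)"
    using assms by (auto simp: orientation_preserving_def xs_def zs_def f_def k_def)
  then obtain us vs where uv: "map f xs = us @ vs" "sorted (vs @ us)"
    by (auto simp: cyclic_seq_iff_rotation)
  have "distinct (map f xs)"
    using partial_isometry_inj[OF assms(1)] xs by (simp add: distinct_map f_def)
  then have d: "distinct (vs @ us)" using uv(1) by auto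
  let ?P = "\<lambda>b. b \<in> dom \<beta>"
  have "filter ?P (vs @ us) = filter (\<lambda>b. b \<in> set (vs @ us)) zs"
  proof (rule sorted_distinct_set_unique)
    show "set (filter ?P (vs @ us)) = set (filter (\<lambda>b. b \<in> set (vs @ us)) zs)"
      using zs by auto
    show "sorted (filter ?P (vs @ us))"
      using sorted_filter[of id "vs @ us" ?P] uv(2) by simp
    show "sorted (filter (\<lambda>b. b \<in> set (vs @ us)) zs)"
      using sorted_filter[of id zs] zs by simp
    show "distinct (filter ?P (vs @ us))" using d by (rule distinct_filter)
    show "distinct (filter (\<lambda>b. b \<in> set (vs @ us)) zs)" using zs by simp
  qed
  with cyclic_seq_filter[OF \<open>cyclic_seq (map k zs)\<close>]
  have "cyclic_seq (map k (filter ?P (vs @ us)))" by metis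
  then have "cyclic_seq (map k (filter ?P us) @ map k (filter ?P vs))"
    using cyclic_seq_rotate by simp
  then have c: "cyclic_seq (map k (filter ?P (map f xs)))" by (simp add: uv(1))
  have "sorted_list_of_set (dom (\<beta> \<circ>\<^sub>m \<alpha>)) = filter (\<lambda>a. f a \<in> dom \<beta>) xs"
  proof (rule sorted_distinct_set_unique)
    have "finite (dom (\<beta> \<circ>\<^sub>m \<alpha>))"
      using finite_dom_isometry[OF partial_isometry_comp[OF assms(1,2)]] .
    then have "set (sorted_list_of_set (dom (\<beta> \<circ>\<^sub>m \<alpha>))) = dom (\<beta> \<circ>\<^sub>m \<alpha>)"
      by (rule set_sorted_list_of_set)
    also have "\<dots> = {a \<in> dom \<alpha>. f a \<in> dom \<beta>}"
      unfolding f_def by (rule Set.set_eqI) (simp only: dom_comp mem_Collect_eq)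
    also have "\<dots> = set (filter (\<lambda>a. f a \<in> dom \<beta>) xs)" by (simp add: xs(1) del: domIff)
    finally show "set (sorted_list_of_set (dom (\<beta> \<circ>\<^sub>m \<alpha>))) = set (filter (\<lambda>a. f a \<in> dom \<beta>) xs)" .
    show "sorted (filter (\<lambda>a. f a \<in> dom \<beta>) xs)"
      using sorted_filter[of id xs] xs by simp
  qed (use xs in auto)
  moreover have "map (\<lambda>a. the ((\<beta> \<circ>\<^sub>m \<alpha>) a)) (filter (\<lambda>a. f a \<in> dom \<beta>) xs)
      = map k (filter ?P (map f xs))"
    using xs by (auto simp: filter_map comp_def f_def k_def the_comp dom_comp simp del: domIff)
  ultimately show ?thesis using c by (simp add: orientation_preserving_def)
qed

lemma partial_isometry_one: "partial_isometry n (Some |` chain n)"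
  using monoid.one_closed[OF monoid_DI] by (simp only: DI_simps)

lemma order_preserving_one: "order_preserving (Some |` A)"
  by (simp add: order_preserving_def the_one del: domIff)

lemma orientation_preserving_one: "orientation_preserving (Some |` chain n)"
proof -
  have "map (\<lambda>a. the ((Some |` chain n) a)) (sorted_list_of_set (chain n))
      = sorted_list_of_set (chain n)"
    by (rule map_idI) (simp del: One_nat_def)
  then show ?thesis
    unfolding orientation_preserving_def dom_one cyclic_seq_iff_rotation
    by (intro exI[of _ "[]"] exI[of _ "sorted_list_of_set (chain n)"]) simp
qed

lemma monotone_comp:
  "order_preserving \<alpha> \<Longrightarrow> order_preserving \<beta> \<Longrightarrow> order_preserving (\<beta> \<circ>\<^sub>m \<alpha>)"
  "order_preserving \<alpha> \<Longrightarrow> order_reversing \<beta> \<Longrightarrow> order_reversing (\<beta> \<circ>\<^sub>m \<alpha>)"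
  "order_reversing \<alpha> \<Longrightarrow> order_preserving \<beta> \<Longrightarrow> order_reversing (\<beta> \<circ>\<^sub>m \<alpha>)"
  "order_reversing \<alpha> \<Longrightarrow> order_reversing \<beta> \<Longrightarrow> order_preserving (\<beta> \<circ>\<^sub>m \<alpha>)"
  by (simp_all add: order_preserving_def order_reversing_def dom_comp the_comp del: domIff)

theorem submonoid_ODI: "submonoid (carrier (ODI n)) (DI n)"
  by (rule submonoid.intro)
    (auto simp: ODI_def DI_simps partial_isometry_comp monotone_comp order_preserving_one
       partial_isometry_one simp del: One_nat_def)

theorem submonoid_MDI: "submonoid (carrier (MDI n)) (DI n)"
  by (rule submonoid.intro)
    (auto simp: MDI_def DI_simps monotone_trans_def partial_isometry_comp monotone_comp
       order_preserving_one partial_isometry_one simp del: One_nat_def)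

theorem submonoid_OPDI: "submonoid (carrier (OPDI n)) (DI n)"
  by (rule submonoid.intro)
    (auto simp: OPDI_def DI_simps partial_isometry_comp orientation_preserving_comp
       orientation_preserving_one partial_isometry_one simp del: One_nat_def)

theorem monoid_ODI: "monoid (ODI n)"
  and monoid_MDI: "monoid (MDI n)"
  and monoid_OPDI: "monoid (OPDI n)"
  using submonoid.submonoid_is_monoid[OF submonoid_ODI monoid_DI]
    submonoid.submonoid_is_monoid[OF submonoid_MDI monoid_DI]
    submonoid.submonoid_is_monoid[OF submonoid_OPDI monoid_DI]
  by (simp_all add: ODI_def MDI_def OPDI_def)

end

theory Submission
  imports Defs
begin

text \<open>
  An order-preserving partial isometry is a restricted translation unless two of its arguments
  \<open>a < b\<close> satisfy \<open>b\<alpha> - a\<alpha> = n - (b - a) \<noteq> b - a\<close>; a third argument would then give inconsistent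
  differences, so \<open>\<alpha>\<close> has rank 2 and equals some \<open>x\<^sub>j\<close> or \<open>y\<^sub>j\<close> between two translations.
  The monotone case follows since \<open>h\<close> turns order-reversing into order-preserving maps, and the
  orientation-preserving case since a suitable rotation of the domain makes the map
  order-preserving, while \<open>x = e\<^sub>n g\<close>, \<open>y = e\<^sub>1 g\<^sup>n\<^sup>-\<^sup>1\<close> and \<open>y\<^sub>j = g\<^sup>j x\<^sub>j g\<^sup>j\<close>.
\<close>

section \<open>Generated submonoids\<close>

text \<open>Built from the same right-folded words as \<open>generates_monoid\<close>, so that
  generation by \<open>A\<close> means that the carrier lies in \<open>span A\<close>.\<close>

definition (in monoid) span :: "'a set \<Rightarrow> 'a set" where
  "span A = {foldr (\<otimes>) ws \<one> | ws. set ws \<subseteq> A}"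

context monoid
begin

lemma foldr_mult_closed: "set ws \<subseteq> carrier G \<Longrightarrow> foldr (\<otimes>) ws \<one> \<in> carrier G"
  by (induction ws) auto

lemma foldr_mult_append:
  "set us \<subseteq> carrier G \<Longrightarrow> set vs \<subseteq> carrier G \<Longrightarrow>
    foldr (\<otimes>) (us @ vs) \<one> = foldr (\<otimes>) us \<one> \<otimes> foldr (\<otimes>) vs \<one>"
  by (induction us) (simp_all add: foldr_mult_closed m_assoc del: foldr_append)

lemma subset_span:
  assumes "A \<subseteq> carrier G"
  shows "A \<subseteq> span A"
proof
  fix a assume "a \<in> A"
  then have "a = foldr (\<otimes>) [a] \<one>" "set [a] \<subseteq> A" using assms by auto
  then show "a \<in> span A" unfolding span_def by blast
qed

lemma submonoid_span:
  assumes "A \<subseteq> carrier G"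
  shows "submonoid (span A) G"
proof (rule submonoid.intro)
  show "span A \<subseteq> carrier G"
    using assms foldr_mult_closed by (fastforce simp: span_def)
  show "\<one> \<in> span A"
    unfolding span_def by (auto intro: exI[of _ "[]"])
next
  fix a b assume "a \<in> span A" "b \<in> span A"
  then obtain us vs where *: "set us \<subseteq> A" "a = foldr (\<otimes>) us \<one>" "set vs \<subseteq> A" "b = foldr (\<otimes>) vs \<one>"
    by (auto simp: span_def)
  then have "a \<otimes> b = foldr (\<otimes>) (us @ vs) \<one>"
    using assms by (subst foldr_mult_append) auto
  moreover have "set (us @ vs) \<subseteq> A" using * by simp
  ultimately show "a \<otimes> b \<in> span A" unfolding span_def by blast
qed

text \<open>\<open>span A\<close> is itself a submonoid containing \<open>A\<close>, so it can be
  taken for \<open>S\<close>. Explicit words are thereby traded for closure arguments in an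
  arbitrary submonoid; changing the carrier leaves product and identity alone.\<close>

lemma generates_monoid_substructure:
  assumes "A \<subseteq> C" "C \<subseteq> carrier G" "\<And>S. submonoid S G \<Longrightarrow> A \<subseteq> S \<Longrightarrow> C \<subseteq> S"
  shows "generates_monoid (G\<lparr>carrier := C\<rparr>) A"
proof -
  have "A \<subseteq> carrier G" using assms(1,2) by blast
  then have "C \<subseteq> span A" using assms(3) submonoid_span subset_span by blast
  then show ?thesis using assms(1) unfolding generates_monoid_def span_def by auto
qed

end


section \<open>Membership of the generators\<close>

text \<open>\<open>cycle_dist n\<close> is symmetric and the diagonal is trivial, so pairs with
  \<open>a < b\<close> suffice.\<close>

lemma partial_isometryI:
  assumes "\<And>a b. \<alpha> a = Some b \<Longrightarrow> a \<in> chain n \<and> b \<in> chain n"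
    and "\<And>a b c d. \<alpha> a = Some c \<Longrightarrow> \<alpha> b = Some d \<Longrightarrow> a < b \<Longrightarrow> cycle_dist n c d = cycle_dist n a b"
  shows "partial_isometry n \<alpha>"
proof -
  have sym: "cycle_dist n u v = cycle_dist n v u" for u v by (simp add: cycle_dist_def abs_minus_commute)
  have "cycle_dist n c d = cycle_dist n a b" if ab: "\<alpha> a = Some c" "\<alpha> b = Some d" for a b c d
  proof (cases a b rule: linorder_cases)
    case equal
    then show ?thesis using ab by (simp add: cycle_dist_def)
  next
    case greater
    then show ?thesis using assms(2)[OF ab(2,1)] sym by metis
  qed (use assms(2) ab in blast)
  then show ?thesis
    using assms(1) unfolding partial_isometry_def partial_trans_def
    by (fastforce simp: dom_def ran_def)
qed

lemma partial_isometry_gen_g: "partial_isometry n (gen_g n)"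
  by (rule partial_isometryI)
     (auto simp: gen_g_def restrict_map_def cycle_dist_def split: if_splits)

lemma partial_isometry_gen_h: "partial_isometry n (gen_h n)"
  by (rule partial_isometryI)
     (auto simp: gen_h_def restrict_map_def cycle_dist_def split: if_splits)

lemma partial_isometry_gen_e: "partial_isometry n (gen_e n i)"
  by (rule partial_isometryI)
     (auto simp: gen_e_def restrict_map_def split: if_splits)

lemma partial_isometry_gen_x: "partial_isometry n (gen_x n)"
  by (rule partial_isometryI)
     (auto simp: gen_x_def restrict_map_def cycle_dist_def split: if_splits)

lemma partial_isometry_gen_y: "partial_isometry n (gen_y n)"
  by (rule partial_isometryI)
     (auto simp: gen_y_def restrict_map_def cycle_dist_def split: if_splits)

text \<open>The arguments differ by \<open>i\<close> and the images by \<open>n - i\<close>; both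
  differences give the distance \<open>min i (n - i)\<close>.\<close>

lemma partial_isometry_gen_xi: "i \<in> {1..(n - 1) div 2} \<Longrightarrow> partial_isometry n (gen_xi n i)"
  by (rule partial_isometryI)
     (auto simp: gen_xi_def cycle_dist_def split: if_splits)

lemma partial_isometry_gen_yi: "i \<in> {1..(n - 1) div 2} \<Longrightarrow> partial_isometry n (gen_yi n i)"
  by (rule partial_isometryI)
     (auto simp: gen_yi_def cycle_dist_def split: if_splits)

lemmas partial_isometry_gens =
  partial_isometry_gen_g partial_isometry_gen_h partial_isometry_gen_e partial_isometry_gen_x
  partial_isometry_gen_y partial_isometry_gen_xi partial_isometry_gen_yi

section \<open>Order and orientation of the generators\<close>

lemma order_preservingI:
  assumes "\<And>a b c d. \<alpha> a = Some c \<Longrightarrow> \<alpha> b = Some d \<Longrightarrow> a < b \<Longrightarrow> c \<le> d"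
  shows "order_preserving \<alpha>"
  unfolding order_preserving_def
proof (intro ballI impI)
  fix a b assume ab: "a \<in> dom \<alpha>" "b \<in> dom \<alpha>" "a \<le> b"
  then obtain c d where "\<alpha> a = Some c" "\<alpha> b = Some d" by blast
  then show "the (\<alpha> a) \<le> the (\<alpha> b)" using ab(3) assms by (cases "a = b") auto
qed

lemma order_preserving_gens:
  "order_preserving (gen_e n i)" "order_preserving (gen_x n)" "order_preserving (gen_y n)"
  "order_preserving (gen_xi n i)" "order_preserving (gen_yi n i)"
  by (rule order_preservingI;
      auto simp: gen_e_def gen_x_def gen_y_def gen_xi_def gen_yi_def restrict_map_def split: if_splits)+

lemma order_reversing_gen_h: "order_reversing (gen_h n)"
  by (auto simp: order_reversing_def gen_h_def restrict_map_def)

lemma orientation_preserving_order_preserving: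
  assumes "finite (dom \<alpha>)" "order_preserving \<alpha>"
  shows "orientation_preserving \<alpha>"
proof -
  have "sorted_wrt (\<lambda>a b. the (\<alpha> a) \<le> the (\<alpha> b)) (sorted_list_of_set (dom \<alpha>))"
    by (rule sorted_wrt_mono_rel[OF _ sorted_sorted_list_of_set])
       (use assms in \<open>simp add: order_preserving_def\<close>)
  then show ?thesis
    unfolding orientation_preserving_def cyclic_seq_iff_rotation
    by (intro exI[of _ "[]"] exI) (auto simp: sorted_map)
qed

lemma orientation_preserving_gen_g:
  assumes "1 \<le> n"
  shows "orientation_preserving (gen_g n)"
proof -
  have "dom (gen_g n) = chain n" by (auto simp: gen_g_def restrict_map_def split: if_splits)
  then have "sorted_list_of_set (dom (gen_g n)) = [1..<n] @ [n]"
    using assms by (simp flip: atLeastLessThanSuc_atLeastAtMost)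
  moreover have "map (\<lambda>a. the (gen_g n a)) [1..<n] = map Suc [1..<n]"
    by (auto simp: gen_g_def)
  ultimately have *: "map (\<lambda>a. the (gen_g n a)) (sorted_list_of_set (dom (gen_g n))) = [2..<Suc n] @ [1]"
    using assms by (simp add: map_Suc_upt gen_g_def numeral_2_eq_2 del: upt_Suc)
  \<comment> \<open>The only possible descent is just before the image 1 of \<open>n\<close>; moving
    this last entry to the front sorts the images.\<close>
  have "sorted ([1] @ [2..<Suc n])" by (simp del: upt_Suc)
  then show ?thesis
    unfolding orientation_preserving_def cyclic_seq_iff_rotation * by blast
qed


section \<open>Order-preserving partial isometries\<close>

context
  fixes n :: nat and S :: "(nat \<rightharpoonup> nat) set"
  assumes S: "submonoid S (DI n)"
begin

section \<open>Partial identities and restricted translations in a submonoid\<close>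

lemma comp_mem: "\<alpha> \<in> S \<Longrightarrow> \<beta> \<in> S \<Longrightarrow> \<beta> \<circ>\<^sub>m \<alpha> \<in> S"
  using submonoid.m_closed[OF S] by (simp add: DI_simps)

lemma chain_mem: "Some |` chain n \<in> S"
  using submonoid.one_closed[OF S] by (simp add: DI_simps)

text \<open>Composing with \<open>gen_e n b\<close> deletes the single point \<open>b\<close> from
  the domain, so induction over the complement of \<open>A\<close> removes its points one by
  one.\<close>

lemma partial_identity_mem:
  assumes e: "\<And>i. i \<in> chain n \<Longrightarrow> gen_e n i \<in> S" and A: "A \<subseteq> chain n"
  shows "Some |` A \<in> S"
proof -
  have "Some |` (chain n - B) \<in> S" if "finite B" "B \<subseteq> chain n" for B
    using that
  proof (induction B rule: finite_induct)
    case (insert b B)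
    have "Some |` (chain n - insert b B) = gen_e n b \<circ>\<^sub>m Some |` (chain n - B)"
      by (rule ext) (auto simp: gen_e_def restrict_map_def map_comp_def)
    then show ?case using insert e by (auto intro: comp_mem)
  qed (simp add: chain_mem del: One_nat_def)
  from this[of "chain n - A"] show ?thesis using A by (simp add: double_diff)
qed

text \<open>Induction on \<open>k\<close> with one factor \<open>gen_x n\<close> per unit. The bound
  \<open>a + k \<le> n\<close> keeps every intermediate image in the domain of the next factor, so
  no argument is lost.\<close>

lemma translation_up_mem:
  assumes x: "gen_x n \<in> S" and id: "\<And>A. A \<subseteq> chain n \<Longrightarrow> Some |` A \<in> S"
    and A: "\<And>a. a \<in> A \<Longrightarrow> 1 \<le> a \<and> a + k \<le> n"
  shows "(\<lambda>a. Some (a + k)) |` A \<in> S"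
  using A
proof (induction k)
  case 0
  then have "Some |` A \<in> S" by (intro id) fastforce
  then show ?case by simp
next
  case (Suc k)
  have "(\<lambda>a. Some (a + Suc k)) |` A = gen_x n \<circ>\<^sub>m (\<lambda>a. Some (a + k)) |` A"
  proof
    fix a
    show "((\<lambda>a. Some (a + Suc k)) |` A) a = (gen_x n \<circ>\<^sub>m (\<lambda>a. Some (a + k)) |` A) a"
      using Suc.prems[of a] by (auto simp: gen_x_def restrict_map_def map_comp_def)
  qed
  moreover have "(\<lambda>a. Some (a + k)) |` A \<in> S"
    by (rule Suc.IH) (drule Suc.prems, simp)
  ultimately show ?case using comp_mem x by simp
qed

text \<open>Mirror image of the upward case; the strict bound \<open>k < a\<close> keeps every
  intermediate image positive, so the subtraction never truncates.\<close>

lemma translation_down_mem: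
  assumes y: "gen_y n \<in> S" and id: "\<And>A. A \<subseteq> chain n \<Longrightarrow> Some |` A \<in> S"
    and A: "\<And>a. a \<in> A \<Longrightarrow> k < a \<and> a \<le> n"
  shows "(\<lambda>a. Some (a - k)) |` A \<in> S"
  using A
proof (induction k)
  case 0
  then have "Some |` A \<in> S" by (intro id) fastforce
  then show ?case by simp
next
  case (Suc k)
  have "(\<lambda>a. Some (a - Suc k)) |` A = gen_y n \<circ>\<^sub>m (\<lambda>a. Some (a - k)) |` A"
  proof
    fix a
    show "((\<lambda>a. Some (a - Suc k)) |` A) a = (gen_y n \<circ>\<^sub>m (\<lambda>a. Some (a - k)) |` A) a"
      using Suc.prems[of a] by (auto simp: gen_y_def restrict_map_def map_comp_def)
  qed
  moreover have "(\<lambda>a. Some (a - k)) |` A \<in> S"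
    by (rule Suc.IH) (drule Suc.prems, simp)
  ultimately show ?case using comp_mem y by simp
qed

lemma carrier_ODI_subset:
  assumes x: "gen_x n \<in> S" and y: "gen_y n \<in> S"
    and e: "\<And>i. i \<in> {2..n - 1} \<Longrightarrow> gen_e n i \<in> S"
    and xi: "\<And>i. i \<in> {1..(n - 1) div 2} \<Longrightarrow> gen_xi n i \<in> S"
    and yi: "\<And>i. i \<in> {1..(n - 1) div 2} \<Longrightarrow> gen_yi n i \<in> S"
  shows "carrier (ODI n) \<subseteq> S"
proof
  fix \<alpha> assume "\<alpha> \<in> carrier (ODI n)"
  then have iso: "partial_isometry n \<alpha>" and op: "order_preserving \<alpha>"
    by (simp_all add: ODI_def DI_simps)
  \<comment> \<open>Only the two end points are missing from \<open>e\<close>: shifting down and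
    back up loses exactly 1, shifting up and back down loses exactly \<open>n\<close>.\<close>
  have "gen_e n i \<in> S" if i: "i \<in> chain n" for i
  proof -
    consider "i = 1" | "i = n" | "i \<in> {2..n - 1}" using i by force
    then show ?thesis
    proof cases
      case 1
      have "gen_e n 1 = gen_x n \<circ>\<^sub>m gen_y n"
        by (rule ext) (auto simp: gen_e_def gen_x_def gen_y_def restrict_map_def map_comp_def)
      then show ?thesis using 1 x y comp_mem by simp
    next
      case 2
      have "gen_e n n = gen_y n \<circ>\<^sub>m gen_x n"
        by (rule ext) (auto simp: gen_e_def gen_x_def gen_y_def restrict_map_def map_comp_def)
      then show ?thesis using 2 x y comp_mem by simp
    qed (use e in auto)
  qed
  then have id: "Some |` A \<in> S" if "A \<subseteq> chain n" for A
    using partial_identity_mem that by blast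
  note up = translation_up_mem[OF x id] and down = translation_down_mem[OF y id]
  have ch: "a \<in> chain n" "b \<in> chain n" if "\<alpha> a = Some b" for a b
    using iso that by (auto simp: partial_isometry_def partial_trans_def ran_def)
  \<comment> \<open>Equal cycle distances mean equal or complementary differences. Both candidates
    are positive because \<open>0 < b - a < n\<close>, whence \<open>c < d\<close>.\<close>
  have diff: "c < d \<and> (d - c = b - a \<or> d - c = n - (b - a))"
    if "\<alpha> a = Some c" "\<alpha> b = Some d" "a < b" for a b c d
  proof -
    have ab: "a \<in> dom \<alpha>" "b \<in> dom \<alpha>" using that by auto
    then have "cycle_dist n (the (\<alpha> a)) (the (\<alpha> b)) = cycle_dist n a b"
      using iso unfolding partial_isometry_def by blast
    moreover have "the (\<alpha> a) \<le> the (\<alpha> b)"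
      using op ab less_imp_le[OF that(3)] unfolding order_preserving_def by blast
    ultimately have "cycle_dist n c d = cycle_dist n a b" "c \<le> d" using that by simp_all
    then show ?thesis using that(3) ch[OF that(1)] ch[OF that(2)]
      by (auto simp: cycle_dist_def min_def of_nat_diff split: if_splits)
  qed
  show "\<alpha> \<in> S"
  proof (cases "\<forall>a b c d. \<alpha> a = Some c \<longrightarrow> \<alpha> b = Some d \<longrightarrow> a < b \<longrightarrow> d - c = b - a")
    case True
    show ?thesis
    proof (cases "dom \<alpha> = {}")
      case True
      then have "\<alpha> = Some |` {}" by auto
      moreover have "Some |` {} \<in> S" by (rule id) simp
      ultimately show ?thesis by simp
    next
      case False
      then obtain p q where pq: "\<alpha> p = Some q" by blast
      \<comment> \<open>The pair \<open>p\<close>, \<open>q\<close> serves as reference point for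
        the translation. The additive form covers both signs of \<open>q - p\<close>, which are
        separated only afterwards.\<close>
      have shift: "b + p = a + q" if "\<alpha> a = Some b" for a b
      proof (cases a p rule: linorder_cases)
        case less
        then have "q - b = p - a" using True pq that by blast
        then show ?thesis using diff[OF that pq less] less by linarith
      next
        case greater
        then have "b - q = a - p" using True pq that by blast
        then show ?thesis using diff[OF pq that greater] greater by linarith
      qed (use pq that in simp)
      show ?thesis
      proof (cases "p \<le> q")
        case True
        have "\<alpha> = (\<lambda>a. Some (a + (q - p))) |` dom \<alpha>"
        proof
          fix a show "\<alpha> a = ((\<lambda>a. Some (a + (q - p))) |` dom \<alpha>) a"
            using shift[of a] True by (cases "\<alpha> a") (auto simp: restrict_map_def)
        qed
        also have "\<dots> \<in> S"
        proof (rule up)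
          fix a assume "a \<in> dom \<alpha>"
          then obtain b where "\<alpha> a = Some b" by blast
          from shift[OF this] ch[OF this] True
          show "1 \<le> a \<and> a + (q - p) \<le> n" by auto
        qed
        finally show ?thesis .
      next
        case False
        have "\<alpha> = (\<lambda>a. Some (a - (p - q))) |` dom \<alpha>"
        proof
          fix a show "\<alpha> a = ((\<lambda>a. Some (a - (p - q))) |` dom \<alpha>) a"
            using shift[of a] False by (cases "\<alpha> a") (auto simp: restrict_map_def)
        qed
        also have "\<dots> \<in> S"
        proof (rule down)
          fix a assume "a \<in> dom \<alpha>"
          then obtain b where "\<alpha> a = Some b" by blast
          from shift[OF this] ch[OF this] False
          show "p - q < a \<and> a \<le> n" by auto
        qed
        finally show ?thesis .
      qed
    qed
  next
    case False
    then obtain a b c d where ab: "\<alpha> a = Some c" "\<alpha> b = Some d" "a < b" "d - c \<noteq> b - a" by blast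
    have cd: "c < d" "d - c = n - (b - a)" using diff[OF ab(1-3)] ab(4) by auto
    \<comment> \<open>For three arguments in order, the outer difference is the sum of the inner
      ones, before and after applying \<open>\<alpha>\<close>. Each choice between a difference and
      its complement then forces a zero gap, \<open>2 * (b - a) = n\<close>, or an image difference
      exceeding \<open>n\<close>.\<close>
    have "u \<in> {a, b}" if u: "\<alpha> u = Some v" for u v
    proof (rule ccontr)
      assume "u \<notin> {a, b}"
      then consider "u < a" | "a < u" "u < b" | "b < u" by force
      then show False
      proof cases
        case 1
        then show False
          using diff[OF u ab(1)] diff[OF u ab(2)] ab cd ch[OF u] ch[OF ab(1)] ch[OF ab(2)] by auto
      next
        case 2
        then show False
          using diff[OF ab(1) u] diff[OF u ab(2)] ab cd ch[OF u] ch[OF ab(1)] ch[OF ab(2)] by auto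
      next
        case 3
        then show False
          using diff[OF ab(1) u] diff[OF ab(2) u] ab cd ch[OF u] ch[OF ab(1)] ch[OF ab(2)] by auto
      qed
    qed
    then have \<alpha>: "\<alpha> u = [a \<mapsto> c, b \<mapsto> d] u" for u
      using ab(1-3) by (cases "\<alpha> u") auto
    define j where "j = b - a"
    \<comment> \<open>Here \<open>2 * j \<noteq> n\<close> restates
      \<open>d - c \<noteq> b - a\<close>: for antipodal arguments the two candidate differences
      coincide.\<close>
    have bj: "b = a + j" "d + j = c + n" "0 < j" "j < n" "2 * j \<noteq> n"
      using ab cd ch[OF ab(1)] ch[OF ab(2)] by (auto simp: j_def)
    \<comment> \<open>The map is \<open>gen_xi n j\<close> for small \<open>j\<close> and
      \<open>gen_yi n (n - j)\<close> otherwise; \<open>2 * j \<noteq> n\<close> puts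
      \<open>n - j\<close> within the index range in the second case.\<close>
    have "[1 \<mapsto> 1, 1 + j \<mapsto> n - j + 1] \<in> S"
    proof (cases "j \<le> (n - 1) div 2")
      case True
      then show ?thesis using xi[of j] bj by (simp add: gen_xi_def)
    next
      case False
      then have "n - j \<in> {1..(n - 1) div 2}" using bj by auto
      from yi[OF this] show ?thesis using bj by (simp add: gen_yi_def)
    qed
    \<comment> \<open>One translation moves \<open>a\<close>, \<open>b\<close> to \<open>1\<close>,
      \<open>1 + j\<close>; the other moves \<open>1\<close>, \<open>n - j + 1\<close> to
      \<open>c\<close>, \<open>d\<close>, as \<open>d = c + (n - j)\<close>.\<close>
    moreover have "(\<lambda>i. Some (i - (a - 1))) |` {a, b} \<in> S"
      using ch[OF ab(1)] ch[OF ab(2)] ab(3) by (intro down) auto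
    moreover have "(\<lambda>i. Some (i + (c - 1))) |` {1, n - j + 1} \<in> S"
      using ch[OF ab(1)] ch[OF ab(2)] bj by (intro up) auto
    moreover have "\<alpha> = (\<lambda>i. Some (i + (c - 1))) |` {1, n - j + 1} \<circ>\<^sub>m
        ([1 \<mapsto> 1, 1 + j \<mapsto> n - j + 1] \<circ>\<^sub>m (\<lambda>i. Some (i - (a - 1))) |` {a, b})"
      using ch[OF ab(1)] ch[OF ab(2)] bj by (intro ext) (auto simp: \<alpha> restrict_map_def map_comp_def)
    ultimately show ?thesis using comp_mem by metis
  qed
qed


section \<open>Monotone partial isometries\<close>

text \<open>Conjugation by the reflection \<open>gen_h n\<close> turns \<open>gen_x n\<close> into
  \<open>gen_y n\<close> and \<open>gen_e n (n - i + 1)\<close> into \<open>gen_e n i\<close>, so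
  half of the idempotents yield all those needed for \<open>carrier (ODI n)\<close>.\<close>

lemma carrier_MDI_subset:
  assumes h: "gen_h n \<in> S" and x: "gen_x n \<in> S"
    and e: "\<And>i. i \<in> {2..(n + 1) div 2} \<Longrightarrow> gen_e n i \<in> S"
    and xi: "\<And>i. i \<in> {1..(n - 1) div 2} \<Longrightarrow> gen_xi n i \<in> S"
    and yi: "\<And>i. i \<in> {1..(n - 1) div 2} \<Longrightarrow> gen_yi n i \<in> S"
  shows "carrier (MDI n) \<subseteq> S"
proof -
  have "gen_y n = gen_h n \<circ>\<^sub>m (gen_x n \<circ>\<^sub>m gen_h n)"
    by (rule ext) (auto simp: gen_h_def gen_x_def gen_y_def restrict_map_def map_comp_def)
  then have y: "gen_y n \<in> S" using h x comp_mem by simp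
  have "gen_e n i \<in> S" if i: "i \<in> {2..n - 1}" for i
  proof (cases "i \<le> (n + 1) div 2")
    case False
    have "gen_e n i = gen_h n \<circ>\<^sub>m (gen_e n (n - i + 1) \<circ>\<^sub>m gen_h n)"
      using i by (intro ext) (auto simp: gen_h_def gen_e_def restrict_map_def map_comp_def)
    moreover have "gen_e n (n - i + 1) \<in> S" using i False by (intro e) auto
    ultimately show ?thesis using h comp_mem by simp
  qed (use e i in simp)
  then have ODI: "carrier (ODI n) \<subseteq> S" using carrier_ODI_subset x y xi yi by blast
  show ?thesis
  proof
    fix \<alpha> assume "\<alpha> \<in> carrier (MDI n)"
    then have iso: "partial_isometry n \<alpha>" and "order_preserving \<alpha> \<or> order_reversing \<alpha>"
      by (simp_all add: MDI_def DI_simps monotone_trans_def)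
    then consider "order_preserving \<alpha>" | "order_reversing \<alpha>" by blast
    then show "\<alpha> \<in> S"
    proof cases
      case 1
      then show ?thesis using iso ODI by (auto simp: ODI_def DI_simps)
    next
      case 2
      then have "gen_h n \<circ>\<^sub>m \<alpha> \<in> carrier (ODI n)"
        using iso by (simp add: ODI_def DI_simps partial_isometry_comp partial_isometry_gens
            monotone_comp order_reversing_gen_h)
      moreover have "v \<in> chain n" if "\<alpha> u = Some v" for u v
        using iso that by (auto simp: partial_isometry_def partial_trans_def ran_def)
      \<comment> \<open>The reflection is an involution on the chain, and all images of
        \<open>\<alpha>\<close> lie in the chain.\<close>
      then have "\<alpha> = gen_h n \<circ>\<^sub>m (gen_h n \<circ>\<^sub>m \<alpha>)"
        by (intro ext) (fastforce simp: gen_h_def restrict_map_def map_comp_def split: option.splits)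
      ultimately show ?thesis using ODI h comp_mem by (metis subsetD)
    qed
  qed
qed

end


section \<open>Orientation-preserving partial isometries\<close>

text \<open>The power \<open>m\<close> of \<open>gen_g n\<close> for \<open>m \<le> n\<close>, in
  closed form: addition modulo \<open>n\<close> with representatives 1 to \<open>n\<close>, so that
  \<open>n\<close> is not sent to 0.\<close>

definition rotation :: "nat \<Rightarrow> nat \<Rightarrow> nat \<rightharpoonup> nat" where
  "rotation n m = (\<lambda>i. Some (if i + m \<le> n then i + m else i + m - n)) |` chain n"

text \<open>When exactly one of two arguments wraps around, their difference is replaced by its
  complement in \<open>n\<close>, which leaves the distance unchanged.\<close>

lemma partial_isometry_rotation: "m \<le> n \<Longrightarrow> partial_isometry n (rotation n m)"
  by (rule partial_isometryI)
     (auto simp: rotation_def restrict_map_def cycle_dist_def split: if_splits)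

lemma rotation_mem:
  assumes S: "submonoid S (DI n)" and g: "gen_g n \<in> S" and "m \<le> n"
  shows "rotation n m \<in> S"
  using assms(3)
proof (induction m)
  case 0
  have "rotation n 0 = Some |` chain n"
    by (rule ext) (auto simp: rotation_def restrict_map_def)
  then show ?case using chain_mem[OF S] by simp
next
  case (Suc m)
  have "rotation n (Suc m) = gen_g n \<circ>\<^sub>m rotation n m"
    using Suc.prems by (intro ext) (auto simp: rotation_def gen_g_def restrict_map_def map_comp_def)
  then show ?case using Suc g comp_mem[OF S] by simp
qed

section \<open>Cutting an orientation-preserving map at its descent\<close>

text \<open>The witness is the last argument before the descent of the image sequence.\<close>

lemma orientation_preserving_split:
  assumes dom: "dom \<alpha> \<subseteq> chain n" and op: "orientation_preserving \<alpha>"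
  obtains m where "m \<le> n"
    and "\<And>a b c d. \<alpha> a = Some c \<Longrightarrow> \<alpha> b = Some d \<Longrightarrow> a \<le> b \<Longrightarrow> b \<le> m \<or> m < a \<Longrightarrow> c \<le> d"
    and "\<And>a b c d. \<alpha> a = Some c \<Longrightarrow> \<alpha> b = Some d \<Longrightarrow> a \<le> m \<Longrightarrow> m < b \<Longrightarrow> d \<le> c"
proof -
  have fin: "finite (dom \<alpha>)" using dom finite_subset by blast
  define xs where "xs = sorted_list_of_set (dom \<alpha>)"
  define f where "f = (\<lambda>a. the (\<alpha> a))"
  have xs: "set xs = dom \<alpha>" "sorted xs" "distinct xs"
    using fin by (auto simp: xs_def)
  obtain as bs where ab: "xs = as @ bs" "sorted (map f (bs @ as))"
    using op unfolding orientation_preserving_def cyclic_seq_iff_rotation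
    by (auto simp: map_eq_append_conv simp flip: xs_def f_def)
  have below: "a < b" if "a \<in> set as" "b \<in> set bs" for a b
    using that xs ab(1) by (fastforce simp: sorted_append order_less_le)
  \<comment> \<open>If \<open>as\<close> is empty there is no lower block; the default 0 lies below
    every argument, so all of them fall into the upper block.\<close>
  define m where "m = (if as = [] then 0 else last as)"
  have as_le: "a \<le> m" if "a \<in> set as" for a
  proof -
    obtain i where i: "i < length as" "a = as ! i" using \<open>a \<in> set as\<close> by (metis in_set_conv_nth)
    have "sorted as" using xs ab(1) by (simp add: sorted_append)
    then have "a \<le> as ! (length as - 1)" unfolding i(2) by (rule sorted_nth_mono) (use i(1) in simp_all)
    then show ?thesis using i(1) by (auto simp: m_def last_conv_nth)
  qed
  have bs_gt: "m < b" if "b \<in> set bs" for b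
  proof (cases "as = []")
    case True
    have "b \<in> dom \<alpha>" using that xs(1) ab(1) by auto
    then show ?thesis using True dom by (fastforce simp: m_def)
  next
    case False
    then show ?thesis using that below by (simp add: m_def)
  qed
  \<comment> \<open>Membership in the two list segments becomes comparison with \<open>m\<close>,
    the form in which the conclusions are stated.\<close>
  have as_iff: "a \<in> set as \<longleftrightarrow> a \<le> m" and bs_iff: "a \<in> set bs \<longleftrightarrow> m < a" if "\<alpha> a = Some c" for a c
  proof -
    have "a \<in> set as \<or> a \<in> set bs" using that xs(1) ab(1) by auto
    then show "a \<in> set as \<longleftrightarrow> a \<le> m" "a \<in> set bs \<longleftrightarrow> m < a"
      using as_le[of a] bs_gt[of a] by auto
  qed
  have mono: "f a \<le> f b" if "a \<le> b" "(a \<in> set as \<and> b \<in> set as) \<or> (a \<in> set bs \<and> b \<in> set bs)" for a b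
  proof -
    have "sorted (map f ys) \<Longrightarrow> sorted ys \<Longrightarrow> distinct ys \<Longrightarrow> a \<in> set ys \<Longrightarrow> b \<in> set ys \<Longrightarrow> f a \<le> f b" for ys
    proof (induction ys)
      case (Cons u ys)
      then show ?case using \<open>a \<le> b\<close> by auto
    qed simp
    then show ?thesis using that(2) ab xs by (auto simp: sorted_append)
  qed
  show thesis
  proof
    show "m \<le> n"
    proof (cases "as = []")
      case False
      then have "m \<in> dom \<alpha>" using xs(1) ab(1) last_in_set[of as] by (auto simp: m_def)
      then show ?thesis using dom by auto
    qed (simp add: m_def)
  next
    fix a b c d assume *: "\<alpha> a = Some c" "\<alpha> b = Some d" "a \<le> b" "b \<le> m \<or> m < a"
    then have "f a \<le> f b" using as_iff bs_iff by (intro mono) auto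
    then show "c \<le> d" using * by (simp add: f_def)
  next
    fix a b c d assume *: "\<alpha> a = Some c" "\<alpha> b = Some d" "a \<le> m" "m < b"
    then have "f b \<le> f a" using ab(2) as_iff bs_iff by (auto simp: sorted_append)
    then show "d \<le> c" using * by (simp add: f_def)
  qed
qed

text \<open>The rotation reads the domain from \<open>m + 1\<close> up to \<open>n\<close> and then
  from 1 to \<open>m\<close>. Images increase weakly on each block, and those of the block above
  \<open>m\<close> come before the others.\<close>

lemma order_preserving_rotated:
  assumes dom: "dom \<alpha> \<subseteq> chain n" and op: "orientation_preserving \<alpha>"
  obtains m where "m \<le> n" "order_preserving (\<alpha> \<circ>\<^sub>m rotation n m)"
proof (rule orientation_preserving_split[OF dom op])
  fix m
  assume m: "m \<le> n"
    and same: "\<And>a b c d. \<alpha> a = Some c \<Longrightarrow> \<alpha> b = Some d \<Longrightarrow> a \<le> b \<Longrightarrow> b \<le> m \<or> m < a \<Longrightarrow> c \<le> d"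
    and diff: "\<And>a b c d. \<alpha> a = Some c \<Longrightarrow> \<alpha> b = Some d \<Longrightarrow> a \<le> m \<Longrightarrow> m < b \<Longrightarrow> d \<le> c"
  have "order_preserving (\<alpha> \<circ>\<^sub>m rotation n m)"
  proof (rule order_preservingI)
    fix a b c d
    assume c: "(\<alpha> \<circ>\<^sub>m rotation n m) a = Some c" and d: "(\<alpha> \<circ>\<^sub>m rotation n m) b = Some d" and "a < b"
    have *: "u \<in> chain n \<and> \<alpha> (if u + m \<le> n then u + m else u + m - n) = Some v"
      if "(\<alpha> \<circ>\<^sub>m rotation n m) u = Some v" for u v
      using that by (cases "u \<in> chain n") (simp_all add: rotation_def map_comp_def del: One_nat_def)
    note a = *[OF c, THEN conjunct1] *[OF c, THEN conjunct2]
    note b = *[OF d, THEN conjunct1] *[OF d, THEN conjunct2]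
    show "c \<le> d"
    \<comment> \<open>As \<open>a < b\<close>, the rotated arguments are in different blocks only if
      \<open>b\<close> wraps and \<open>a\<close> does not; then \<open>b\<close> lands at or below
      \<open>m\<close>, so \<open>diff\<close> takes the two in swapped order.\<close>
    proof (cases "a + m \<le> n \<and> \<not> b + m \<le> n")
      case True
      show ?thesis using True b(1) a(1) by (intro diff[OF b(2) a(2)]) auto
    next
      case False
      show ?thesis using False a(1) b(1) \<open>a < b\<close> by (intro same[OF a(2) b(2)]) auto
    qed
  qed
  with m show thesis by (rule that)
qed

text \<open>One idempotent suffices because conjugation by rotations moves its missing point
  anywhere. Once the generators of \<open>carrier (ODI n)\<close> are available, each
  \<open>\<alpha>\<close> is rotated into that monoid and back.\<close>

lemma carrier_OPDI_subset:
  assumes S: "submonoid S (DI n)" and g: "gen_g n \<in> S" and k: "k \<in> chain n" "gen_e n k \<in> S"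
    and xi: "\<And>i. i \<in> {1..(n - 1) div 2} \<Longrightarrow> gen_xi n i \<in> S"
  shows "carrier (OPDI n) \<subseteq> S"
proof -
  note comp = comp_mem[OF S] and rot = rotation_mem[OF S g]
  have e: "gen_e n i \<in> S" if i: "i \<in> chain n" for i
  proof -
    \<comment> \<open>The amount of rotation carrying \<open>i\<close> to \<open>k\<close>, with a
      wrap past \<open>n\<close> when \<open>k < i\<close>.\<close>
    obtain m where m: "m \<le> n" "(if i + m \<le> n then i + m else i + m - n) = k"
    proof (cases "i \<le> k")
      case True
      then show thesis using k by (intro that[of "k - i"]) auto
    next
      case False
      then show thesis using i k by (intro that[of "k + n - i"]) auto
    qed
    have "gen_e n i = rotation n (n - m) \<circ>\<^sub>m (gen_e n k \<circ>\<^sub>m rotation n m)"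
    proof
      fix a show "gen_e n i a = (rotation n (n - m) \<circ>\<^sub>m (gen_e n k \<circ>\<^sub>m rotation n m)) a"
      proof (cases "a \<in> chain n \<and> a \<noteq> i")
        case True
        then have "(if a + m \<le> n then a + m else a + m - n) \<in> chain n - {k}"
          using i m by (auto split: if_splits)
        then show ?thesis
          using True m(1) by (auto simp: rotation_def gen_e_def restrict_map_def map_comp_def)
      next
        case False
        then show ?thesis
          using i m by (auto simp: rotation_def gen_e_def restrict_map_def map_comp_def)
      qed
    qed
    then show ?thesis using comp rot m k(2) by simp
  qed
  have "1 \<in> chain n" "n \<in> chain n" using k by auto
  note e1 = e[OF this(1)] and en = e[OF this(2)]
  have "gen_x n = gen_g n \<circ>\<^sub>m gen_e n n"
    by (rule ext) (auto simp: gen_x_def gen_e_def gen_g_def restrict_map_def map_comp_def)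
  then have x: "gen_x n \<in> S" using en g comp by simp
  have "gen_y n = rotation n (n - 1) \<circ>\<^sub>m gen_e n 1"
    by (rule ext) (auto simp: gen_y_def gen_e_def rotation_def restrict_map_def map_comp_def)
  then have y: "gen_y n \<in> S" using e1 rot comp by simp
  have yi: "gen_yi n i \<in> S" if i: "i \<in> {1..(n - 1) div 2}" for i
  proof -
    \<comment> \<open>The points travel \<open>1\<close>, \<open>1 + i\<close>,
      \<open>n - i + 1\<close>, \<open>1\<close> and \<open>n - i + 1\<close>, \<open>1\<close>,
      \<open>1\<close>, \<open>1 + i\<close>; the first rotation sends no other point into the
      domain of \<open>gen_xi n i\<close>.\<close>
    have "gen_yi n i = rotation n i \<circ>\<^sub>m (gen_xi n i \<circ>\<^sub>m rotation n i)"
      using i by (intro ext)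
        (auto simp: gen_yi_def gen_xi_def rotation_def restrict_map_def map_comp_def)
    moreover have "rotation n i \<in> S" using i by (intro rot) auto
    ultimately show ?thesis using i xi comp by simp
  qed
  have ODI: "carrier (ODI n) \<subseteq> S"
    using e by (intro carrier_ODI_subset[OF S x y _ xi yi]) auto
  show ?thesis
  proof
    fix \<alpha> assume "\<alpha> \<in> carrier (OPDI n)"
    then have iso: "partial_isometry n \<alpha>" and op: "orientation_preserving \<alpha>"
      by (simp_all add: OPDI_def DI_simps)
    then have dom: "dom \<alpha> \<subseteq> chain n" by (simp add: partial_isometry_def partial_trans_def)
    obtain m where m: "m \<le> n" "order_preserving (\<alpha> \<circ>\<^sub>m rotation n m)"
      using order_preserving_rotated[OF dom op] .
    then have "\<alpha> \<circ>\<^sub>m rotation n m \<in> S"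
      using ODI iso by (auto simp: ODI_def DI_simps partial_isometry_comp partial_isometry_rotation)
    moreover have "\<alpha> u = None" if "u \<notin> chain n" for u using that dom by blast
    \<comment> \<open>Rotating by \<open>n - m\<close> and then by \<open>m\<close> is the identity
      on the chain, which contains the domain of \<open>\<alpha>\<close>.\<close>
    then have "\<alpha> = (\<alpha> \<circ>\<^sub>m rotation n m) \<circ>\<^sub>m rotation n (n - m)"
      using m(1) by (intro ext) (auto simp: rotation_def restrict_map_def map_comp_def)
    ultimately show "\<alpha> \<in> S" using comp rot by (metis diff_le_self)
  qed
qed


section \<open>The generating sets\<close>

theorem proposition4p1:
  fixes n :: nat
  assumes "3 \<le> n"
  shows "generates_monoid (ODI n)
           ({gen_x n, gen_y n} \<union> gen_e n ` {2..n - 1}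
             \<union> gen_xi n ` {1..(n - 1) div 2} \<union> gen_yi n ` {1..(n - 1) div 2})
       \<and> generates_monoid (MDI n)
           ({gen_h n, gen_x n} \<union> gen_e n ` {2..(n + 1) div 2}
             \<union> gen_xi n ` {1..(n - 1) div 2} \<union> gen_yi n ` {1..(n - 1) div 2})
       \<and> (\<forall>i\<in>{1..n}. generates_monoid (OPDI n)
           ({gen_g n, gen_e n i} \<union> gen_xi n ` {1..(n - 1) div 2}))"
proof (intro conjI ballI)
  let ?xi = "gen_xi n ` {1..(n - 1) div 2}" and ?yi = "gen_yi n ` {1..(n - 1) div 2}"
  note generates = monoid.generates_monoid_substructure[OF monoid_DI]
  let ?A = "{gen_x n, gen_y n} \<union> gen_e n ` {2..n - 1} \<union> ?xi \<union> ?yi"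
  show "generates_monoid (ODI n) ?A"
    unfolding ODI_def
  proof (rule generates)
    show "?A \<subseteq> {\<alpha> \<in> carrier (DI n). order_preserving \<alpha>}"
      by (auto simp: DI_simps partial_isometry_gens order_preserving_gens)
    fix S assume "submonoid S (DI n)" "?A \<subseteq> S"
    then have "carrier (ODI n) \<subseteq> S" by (intro carrier_ODI_subset) (simp_all add: image_subset_iff)
    then show "{\<alpha> \<in> carrier (DI n). order_preserving \<alpha>} \<subseteq> S" by (simp add: ODI_def)
  qed blast
  let ?B = "{gen_h n, gen_x n} \<union> gen_e n ` {2..(n + 1) div 2} \<union> ?xi \<union> ?yi"
  show "generates_monoid (MDI n) ?B"
    unfolding MDI_def
  proof (rule generates)
    show "?B \<subseteq> {\<alpha> \<in> carrier (DI n). monotone_trans \<alpha>}"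
      by (auto simp: DI_simps monotone_trans_def partial_isometry_gens order_preserving_gens
          order_reversing_gen_h)
    fix S assume "submonoid S (DI n)" "?B \<subseteq> S"
    then have "carrier (MDI n) \<subseteq> S" by (intro carrier_MDI_subset) (simp_all add: image_subset_iff)
    then show "{\<alpha> \<in> carrier (DI n). monotone_trans \<alpha>} \<subseteq> S" by (simp add: MDI_def)
  qed blast
  fix i assume i: "i \<in> {1..n}"
  let ?C = "{gen_g n, gen_e n i} \<union> ?xi"
  show "generates_monoid (OPDI n) ?C"
    unfolding OPDI_def
  proof (rule generates)
    have "orientation_preserving \<alpha>" if "\<alpha> \<in> ?C" for \<alpha>
    proof -
      \<comment> \<open>Only \<open>gen_g n\<close> needs its own orientation argument; the other
        generators are order-preserving.\<close>
      consider "\<alpha> = gen_g n" | "partial_isometry n \<alpha>" "order_preserving \<alpha>"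
        using \<open>\<alpha> \<in> ?C\<close> by (auto simp: partial_isometry_gens order_preserving_gens)
      then show ?thesis
        using assms orientation_preserving_gen_g orientation_preserving_order_preserving
          finite_dom_isometry by cases auto
    qed
    then show "?C \<subseteq> {\<alpha> \<in> carrier (DI n). orientation_preserving \<alpha>}"
      by (auto simp: DI_simps partial_isometry_gens)
    fix S assume "submonoid S (DI n)" "?C \<subseteq> S"
    then have "carrier (OPDI n) \<subseteq> S" using i by (intro carrier_OPDI_subset[of S n i]) (simp_all add: image_subset_iff)
    then show "{\<alpha> \<in> carrier (DI n). orientation_preserving \<alpha>} \<subseteq> S" by (simp add: OPDI_def)
  qed blast
qed

end
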